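(* Let $n_1,\dots,n_k$ be positive integers with $n_1+\cdots+n_k=n$. Let $C$ be an $n\times n$ complex positive definite matrix and let $D=D_1\oplus\cdots\oplus D_k$, where each $D_i$ is an $n_i\times n_i$ complex positive definite matrix. Partition $C$ into blocks according to $(n_1,\dots,n_k)$, and let $C_1,\dots,C_k$ (with $C_i$ of size $n_i\times n_i$) be its diagonal blocks, so that the main block diagonal of $C$ is $C_1\oplus\cdots\oplus C_k$. Then for every real $p\ge 0$, $$\det\left(I_{n_1}+(C_1^{-1}D_1)^p\right)\cdots\det\left(I_{n_k}+(C_k^{-1}D_k)^p\right)\le\det\left(I_n+(C^{-1}D)^p\right).$$
   Context: Positive definite matrices are Hermitian. The symbol $\oplus$ denotes the block diagonal direct sum of matrices, and $I_m$ is the $m\times m$ identity matrix. Real powers: if $X$ is a diagonalizable complex $m\times m$ matrix with positive real eigenvalues, $X=S\,\mathrm{diag}(\xi_1,\dots,\xi_m)S^{-1}$ with $S$ nonsingular and $\xi_i>0$, then $X^p:=S\,\mathrm{diag}(\xi_1^p,\dots,\xi_m^p)S^{-1}$ for $p\in\mathbb{R}$; this is independent of the choice of diagonalization. A product $AB$ of two positive definite matrices is diagonalizable with positive eigenvalues (it is similar to $B^{1/2}AB^{1/2}$), so the powers in the claim are defined. *)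

theory Defs
  imports
    Complex_Main
    "Jordan_Normal_Form.Determinant"
    "Jordan_Normal_Form.Gauss_Jordan_Elimination"
    "Jordan_Normal_Form.Schur_Decomposition"
begin

text \<open>\<open>(A *\<^sub>v v) \<bullet>c v\<close> is the quadratic form of \<open>A\<close> at \<open>v\<close>; it is real because \<open>A\<close> is Hermitian.\<close>

definition pos_def :: "nat \<Rightarrow> complex mat \<Rightarrow> bool" where
  "pos_def m A \<longleftrightarrow> A \<in> carrier_mat m m \<and> mat_adjoint A = A \<and>
     (\<forall>v \<in> carrier_vec m. v \<noteq> 0\<^sub>v m \<longrightarrow> Re ((A *\<^sub>v v) \<bullet>c v) > 0)"

definition is_real_power :: "complex mat \<Rightarrow> real \<Rightarrow> complex mat \<Rightarrow> bool" where
  "is_real_power X p Y \<longleftrightarrow> (\<exists>S T (\<xi> :: nat \<Rightarrow> real).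
     similar_mat_wit X (mat_diag (dim_row X) (\<lambda>i. complex_of_real (\<xi> i))) S T \<and>
     (\<forall>i < dim_row X. \<xi> i > 0) \<and>
     Y = S * mat_diag (dim_row X) (\<lambda>i. complex_of_real (\<xi> i powr p)) * T)"

text \<open>The power does not depend on the chosen diagonalization, so the description in
  \<open>mat_powr\<close> below is proper.\<close>

lemma is_real_power_unique:
  assumes "is_real_power X p Y" "is_real_power X p Y'"
  shows "Y = Y'"
proof -
  define m where "m = dim_row X"
  define d where "d \<xi> = mat_diag m (\<lambda>i. complex_of_real (\<xi> i))" for \<xi>
  obtain S T \<xi> where 1: "similar_mat_wit X (d \<xi>) S T"
    and Y: "Y = S * d (\<lambda>i. \<xi> i powr p) * T"
    using assms(1) unfolding is_real_power_def d_def m_def by blast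
  obtain S' T' \<xi>' where 2: "similar_mat_wit X (d \<xi>') S' T'"
    and Y': "Y' = S' * d (\<lambda>i. \<xi>' i powr p) * T'"
    using assms(2) unfolding is_real_power_def d_def m_def by blast
  have c [simp]: "S \<in> carrier_mat m m" "T \<in> carrier_mat m m"
      "S' \<in> carrier_mat m m" "T' \<in> carrier_mat m m"
    and dc [simp]: "\<And>f. d f \<in> carrier_mat m m"
    and i: "S * T = 1\<^sub>m m" "T * S = 1\<^sub>m m" "S' * T' = 1\<^sub>m m" "T' * S' = 1\<^sub>m m"
    and X: "X = S * d \<xi> * T" "X = S' * d \<xi>' * T'"
    using 1 2 unfolding similar_mat_wit_def Let_def m_def[symmetric] d_def
    by (auto simp: mat_diag_def)
  define W where "W = T' * S"
  have W [simp]: "W \<in> carrier_mat m m" unfolding W_def by (rule mult_carrier_mat[of _ _ m]) auto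
  have l: "T' * (S * M * T) * S = W * M" if [simp]: "M \<in> carrier_mat m m" for M
  proof -
    have "T' * (S * M * T) * S = T' * (S * M * (T * S))"
      by (simp add: assoc_mult_mat[of _ m m _ m _ m] mult_carrier_mat[of _ m m _ m])
    also have "\<dots> = W * M" unfolding i W_def
      by (simp add: assoc_mult_mat[of _ m m _ m _ m] right_mult_one_mat[of _ m m]
          mult_carrier_mat[of _ m m _ m])
    finally show ?thesis .
  qed
  have r: "T' * (S' * M * T') * S = M * W" if [simp]: "M \<in> carrier_mat m m" for M
  proof -
    have "T' * (S' * M * T') * S = (T' * S') * M * (T' * S)"
      by (simp add: assoc_mult_mat[of _ m m _ m _ m] mult_carrier_mat[of _ m m _ m])
    then show ?thesis unfolding i W_def by (simp add: left_mult_one_mat[of _ m m])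
  qed
  have eq: "W * d \<xi> = d \<xi>' * W"
    using l[of "d \<xi>"] r[of "d \<xi>'"] X by simp
  have ent: "W $$ (a,b) * \<xi> b = \<xi>' a * W $$ (a,b)" if "a < m" "b < m" for a b
  proof -
    have "(W * d \<xi>) $$ (a,b) = (d \<xi>' * W) $$ (a,b)" using eq by simp
    then show ?thesis using that unfolding d_def
      by (simp add: mat_diag_mult_right[of W m m] mat_diag_mult_left[of W m m])
  qed
  have "W * d (\<lambda>i. \<xi> i powr p) = d (\<lambda>i. \<xi>' i powr p) * W"
    unfolding d_def mat_diag_mult_right[OF W] mat_diag_mult_left[OF W]
  proof (rule eq_matI)
    fix a b
    assume "a < dim_row (Matrix.mat m m (\<lambda>(i, j). complex_of_real (\<xi>' i powr p) * W $$ (i, j)))"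
      and "b < dim_col (Matrix.mat m m (\<lambda>(i, j). complex_of_real (\<xi>' i powr p) * W $$ (i, j)))"
    then have ab: "a < m" "b < m" by simp_all
    from ent[OF this] have "W $$ (a,b) = 0 \<or> \<xi> b = \<xi>' a" by (simp add: mult.commute)
    with ab show "Matrix.mat m m (\<lambda>(i, j). W $$ (i, j) * complex_of_real (\<xi> j powr p)) $$ (a, b)
        = Matrix.mat m m (\<lambda>(i, j). complex_of_real (\<xi>' i powr p) * W $$ (i, j)) $$ (a, b)"
      by auto
  qed simp_all
  then have *: "T' * Y * S = T' * Y' * S" unfolding Y Y' using l r by simp
  have inv: "S' * (T' * M * S) * T = M" if [simp]: "M \<in> carrier_mat m m" for M
  proof -
    have "S' * (T' * M * S) * T = (S' * T') * M * (S * T)"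
      by (simp add: assoc_mult_mat[of _ m m _ m _ m] mult_carrier_mat[of _ m m _ m])
    then show ?thesis unfolding i by (simp add: left_mult_one_mat[of _ m m] right_mult_one_mat[of _ m m])
  qed
  have "Y \<in> carrier_mat m m" "Y' \<in> carrier_mat m m" unfolding Y Y'
    by (auto intro!: mult_carrier_mat[of _ m m])
  with * inv show ?thesis by metis
qed

text \<open>\<open>mat_powr X p\<close> is meaningful only for diagonalizable \<open>X\<close> with positive real eigenvalues.\<close>

definition mat_powr :: "complex mat \<Rightarrow> real \<Rightarrow> complex mat" where
  "mat_powr X p = (THE Y. is_real_power X p Y)"

lemma mat_powr_eqI: "is_real_power X p Y \<Longrightarrow> mat_powr X p = Y"
  unfolding mat_powr_def using is_real_power_unique by blast

text \<open>The library inverse is option-valued; \<open>mat_inv\<close> is meaningful for nonsingular matrices.\<close>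

definition mat_inv :: "complex mat \<Rightarrow> complex mat" where
  "mat_inv A = the (mat_inverse A)"

text \<open>Blocks are numbered from \<open>0\<close>; block \<open>i\<close> has size \<open>ns i\<close> and so starts at
  row and column \<open>\<Sum>j<i. ns j\<close>.\<close>

definition diag_block :: "(nat \<Rightarrow> nat) \<Rightarrow> 'a mat \<Rightarrow> nat \<Rightarrow> 'a mat" where
  "diag_block ns C i = mat (ns i) (ns i)
     (\<lambda>(a, b). C $$ ((\<Sum>j<i. ns j) + a, (\<Sum>j<i. ns j) + b))"

end

theory Submission
  imports Defs "HOL-Analysis.Convex" "HOL-Computational_Algebra.Fundamental_Theorem_Algebra"
begin

text \<open>If \<open>S\<^sup>* D S = 1\<close> and \<open>S\<^sup>* C S = diag(x)\<close>, then \<open>C\<^sup>-\<^sup>1 D = S diag(1 / x) S\<^sup>-\<^sup>1\<close> and therefore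
  \<open>det (1 + (C\<^sup>-\<^sup>1 D)\<^sup>p)\<close> is the product of the numbers \<open>1 + x\<^sub>i\<^sup>-\<^sup>p\<close> (\<open>det_one_plus_powr\<close>). Such an \<open>S\<close>
  exists for every pair of positive definite matrices (\<open>simultaneous_diagonalization\<close>), so the claim
  becomes a comparison of two lists of positive numbers.

  Choose such an \<open>S\<^sub>i\<close> for each pair \<open>(C\<^sub>i, D\<^sub>i)\<close> and let \<open>S\<close> be the direct sum of the \<open>S\<^sub>i\<close>. Then
  \<open>S\<^sup>* D S = 1\<close>, because \<open>D\<close> is block diagonal, and the numbers belonging to all the blocks together
  are exactly the diagonal entries of \<open>E = S\<^sup>* C S\<close>. If a unitary \<open>W\<close> diagonalizes \<open>E\<close>, then \<open>S W\<close>
  simultaneously diagonalizes \<open>C\<close> and \<open>D\<close>, so the numbers belonging to the whole pair are the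
  eigenvalues of \<open>E\<close>. It remains to compare the diagonal of a positive definite matrix with its
  eigenvalues. The diagonal entries are averages of the eigenvalues with doubly stochastic weights,
  so the sum of a convex function over the diagonal is at most its sum over the eigenvalues
  (\<open>unitary_congruence_trace_convex\<close>). The function \<open>ln (1 + t\<^sup>-\<^sup>p)\<close> is convex on the positive reals
  for \<open>p \<ge> 0\<close> (\<open>convex_ln_one_plus_powr\<close>), and exponentiating gives the inequality of products.\<close>

section \<open>Adjoints, congruences and positive definite matrices\<close>

lemma dim_mat_adjoint [simp]:
  "dim_row (mat_adjoint A) = dim_col A" "dim_col (mat_adjoint A) = dim_row A"
  by (simp_all add: mat_adjoint_def)

lemma mat_adjoint_carrier [simp]:
  "A \<in> carrier_mat n m \<Longrightarrow> mat_adjoint A \<in> carrier_mat m n"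
  by (intro carrier_matI) (simp_all only: dim_mat_adjoint carrier_matD)

lemma mat_adjoint_index [simp]:
  "i < dim_col A \<Longrightarrow> j < dim_row A \<Longrightarrow> mat_adjoint A $$ (i, j) = conjugate (A $$ (j, i))"
  by (simp add: mat_adjoint_def mat_of_rows_index)

lemma mat_adjoint_adjoint [simp]: "mat_adjoint (mat_adjoint A) = A"
  by (rule eq_matI) auto

lemma mat_adjoint_one [simp]: "mat_adjoint (1\<^sub>m n :: complex mat) = 1\<^sub>m n"
  by (rule eq_matI) auto

lemma mat_adjoint_mult:
  fixes A B :: "complex mat"
  assumes "A \<in> carrier_mat n m" "B \<in> carrier_mat m l"
  shows "mat_adjoint (A * B) = mat_adjoint B * mat_adjoint A"
  using assms by (intro eq_matI) (auto simp: scalar_prod_def mult.commute)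

lemma adjoint_sprod:
  fixes P :: "complex mat"
  assumes "P \<in> carrier_mat n m" "z \<in> carrier_vec n" "x \<in> carrier_vec m"
  shows "(mat_adjoint P *\<^sub>v z) \<bullet>c x = z \<bullet>c (P *\<^sub>v x)"
proof -
  have "(mat_adjoint P *\<^sub>v z) \<bullet>c x = (\<Sum>i<m. \<Sum>j<n. z $ j * (cnj (P $$ (j, i)) * cnj (x $ i)))"
    using assms by (auto simp: scalar_prod_def sum_distrib_right sum_distrib_left atLeast0LessThan
        ac_simps intro!: sum.cong)
  also have "\<dots> = (\<Sum>j<n. \<Sum>i<m. z $ j * (cnj (P $$ (j, i)) * cnj (x $ i)))"
    by (rule sum.swap)
  also have "\<dots> = z \<bullet>c (P *\<^sub>v x)"
    using assms by (auto simp: scalar_prod_def sum_distrib_left atLeast0LessThan intro!: sum.cong)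
  finally show ?thesis .
qed

text \<open>The congruence \<open>P\<^sup>* M Q\<close> represents the sesquilinear form of \<open>M\<close> pulled back along \<open>P\<close> and
  \<open>Q\<close>. Rectangular \<open>P\<close> and \<open>Q\<close> are allowed, so that restricting a form to a subspace and changing
  basis are the same operation.\<close>

lemma congruence_sprod:
  fixes M :: "complex mat"
  assumes "M \<in> carrier_mat n n'" "P \<in> carrier_mat n m" "Q \<in> carrier_mat n' l"
    and "x \<in> carrier_vec m" "y \<in> carrier_vec l"
  shows "((mat_adjoint P * M * Q) *\<^sub>v y) \<bullet>c x = (M *\<^sub>v (Q *\<^sub>v y)) \<bullet>c (P *\<^sub>v x)"
proof -
  have c: "mat_adjoint P \<in> carrier_mat m n" "mat_adjoint P * M \<in> carrier_mat m n'"
    "Q *\<^sub>v y \<in> carrier_vec n'" "M *\<^sub>v (Q *\<^sub>v y) \<in> carrier_vec n"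
    using assms by auto
  have "(mat_adjoint P * M * Q) *\<^sub>v y = (mat_adjoint P * M) *\<^sub>v (Q *\<^sub>v y)"
    by (rule assoc_mult_mat_vec[OF c(2) assms(3,5)])
  also have "\<dots> = mat_adjoint P *\<^sub>v (M *\<^sub>v (Q *\<^sub>v y))"
    by (rule assoc_mult_mat_vec[OF c(1) assms(1) c(3)])
  finally show ?thesis by (simp only: adjoint_sprod[OF assms(2) c(4) assms(4)])
qed

lemma mult_unit_vec:
  fixes A :: "complex mat"
  assumes "A \<in> carrier_mat n m" "j < m"
  shows "A *\<^sub>v unit_vec m j = col A j"
  using assms by (intro eq_vecI) auto

lemma index_eq_sprod:
  fixes A :: "complex mat"
  assumes "A \<in> carrier_mat n m" "i < n" "j < m"
  shows "A $$ (i, j) = (A *\<^sub>v unit_vec m j) \<bullet>c unit_vec n i"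
proof -
  have "conjugate (unit_vec n i :: complex vec) = unit_vec n i"
    by (rule eq_vecI) (use assms in \<open>auto simp: unit_vec_def\<close>)
  then show ?thesis using assms by (simp add: mult_unit_vec[of A n m])
qed

text \<open>Entries of a congruence are values of the form of \<open>M\<close> at pairs of columns. All computations
  with \<open>S\<^sup>* M S\<close> below go through this formula, which reduces them to statements about the columns
  of \<open>S\<close>.\<close>

lemma congruence_index:
  fixes M :: "complex mat"
  assumes "M \<in> carrier_mat n n'" "P \<in> carrier_mat n m" "Q \<in> carrier_mat n' l" "i < m" "j < l"
  shows "(mat_adjoint P * M * Q) $$ (i, j) = (M *\<^sub>v col Q j) \<bullet>c col P i"
proof -
  have "mat_adjoint P * M * Q \<in> carrier_mat m l"
    using assms by (intro mult_carrier_mat[of _ m n'] mult_carrier_mat[of _ m n]) auto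
  from index_eq_sprod[OF this assms(4,5)] show ?thesis
    unfolding congruence_sprod[OF assms(1-3) unit_vec_carrier unit_vec_carrier]
      mult_unit_vec[OF assms(2,4)] mult_unit_vec[OF assms(3,5)] .
qed

lemma pos_def_carrier: "pos_def n A \<Longrightarrow> A \<in> carrier_mat n n"
  by (simp add: pos_def_def)

lemma pos_def_adjoint: "pos_def n A \<Longrightarrow> mat_adjoint A = A"
  by (simp add: pos_def_def)

lemma pos_def_positive:
  "pos_def n A \<Longrightarrow> v \<in> carrier_vec n \<Longrightarrow> v \<noteq> 0\<^sub>v n \<Longrightarrow> 0 < Re ((A *\<^sub>v v) \<bullet>c v)"
  by (simp add: pos_def_def)

lemma pos_def_sprod_commute:
  assumes "pos_def n A" "x \<in> carrier_vec n" "y \<in> carrier_vec n"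
  shows "(A *\<^sub>v x) \<bullet>c y = cnj ((A *\<^sub>v y) \<bullet>c x)"
proof -
  have A: "A \<in> carrier_mat n n" using assms by (simp add: pos_def_carrier)
  have Ay: "A *\<^sub>v y \<in> carrier_vec n" using A assms by simp
  have "(A *\<^sub>v x) \<bullet>c y = x \<bullet>c (A *\<^sub>v y)"
    using adjoint_sprod[OF A assms(2,3)] pos_def_adjoint[OF assms(1)] by simp
  also have "\<dots> = conjugate (conjugate x \<bullet> (A *\<^sub>v y))"
    using conjugate_conjugate_sprod[OF assms(2) Ay] by simp
  also have "conjugate x \<bullet> (A *\<^sub>v y) = (A *\<^sub>v y) \<bullet>c x"
    using conjugate_vec_sprod_comm[OF Ay assms(2)] by simp
  finally show ?thesis by simp
qed

lemma pos_def_form_real: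
  assumes "pos_def n A" "x \<in> carrier_vec n"
  shows "(A *\<^sub>v x) \<bullet>c x = of_real (Re ((A *\<^sub>v x) \<bullet>c x))"
  using pos_def_sprod_commute[OF assms(1) assms(2) assms(2)]
  by (metis Reals_cnj_iff of_real_Re)

text \<open>Restriction of a positive definite form to the range of an injective map: besides changes of
  basis this covers the passage to a complement of a vector and to a diagonal block.\<close>

lemma pos_def_congruence:
  assumes M: "pos_def n M" and P: "P \<in> carrier_mat n m"
    and inj: "\<And>x. x \<in> carrier_vec m \<Longrightarrow> x \<noteq> 0\<^sub>v m \<Longrightarrow> P *\<^sub>v x \<noteq> 0\<^sub>v n"
  shows "pos_def m (mat_adjoint P * M * P)"
proof -
  have c: "M \<in> carrier_mat n n" "mat_adjoint P * M \<in> carrier_mat m n"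
    using M P by (auto simp: pos_def_carrier intro!: mult_carrier_mat[of _ m n])
  have "mat_adjoint (mat_adjoint P * M * P) = mat_adjoint P * M * P"
    unfolding mat_adjoint_mult[OF c(2) P] mat_adjoint_mult[OF mat_adjoint_carrier[OF P] c(1)]
    using c P M by (simp add: pos_def_adjoint assoc_mult_mat[of _ m n _ n _ m])
  moreover have "Re (((mat_adjoint P * M * P) *\<^sub>v x) \<bullet>c x) > 0"
    if "x \<in> carrier_vec m" "x \<noteq> 0\<^sub>v m" for x
    unfolding congruence_sprod[OF c(1) P P that(1) that(1)]
    by (rule pos_def_positive[OF M mult_mat_vec_carrier[OF P that(1)] inj[OF that]])
  moreover have "mat_adjoint P * M * P \<in> carrier_mat m m" using c P by simp
  ultimately show ?thesis unfolding pos_def_def by auto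
qed

lemma pos_def_one: "pos_def n (1\<^sub>m n)"
  unfolding pos_def_def
proof (intro conjI ballI impI)
  fix v :: "complex vec" assume "v \<in> carrier_vec n" "v \<noteq> 0\<^sub>v n"
  then have "v \<bullet>c v > 0" by simp
  then show "Re ((1\<^sub>m n *\<^sub>v v) \<bullet>c v) > 0" using \<open>v \<in> carrier_vec n\<close>
    by (simp add: less_complex_def)
qed auto

lemma pos_def_obtain_inverse:
  assumes "pos_def n A"
  obtains B where "B \<in> carrier_mat n n" "A * B = 1\<^sub>m n" "B * A = 1\<^sub>m n"
proof -
  have A: "A \<in> carrier_mat n n" using assms by (rule pos_def_carrier)
  have "A *\<^sub>v v \<noteq> 0\<^sub>v n" if "v \<in> carrier_vec n" "v \<noteq> 0\<^sub>v n" for v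
  proof
    assume "A *\<^sub>v v = 0\<^sub>v n"
    then have "(A *\<^sub>v v) \<bullet>c v = 0" using that by simp
    then show False using assms that unfolding pos_def_def by force
  qed
  then have "det A \<noteq> 0" using det_0_iff_vec_prod_zero[OF A] by blast
  from det_non_zero_imp_unit[OF A this] show ?thesis
    unfolding Units_def ring_mat_def using that by auto
qed

text \<open>An eigenvector of \<open>D\<^sup>-\<^sup>1 C\<close>, which exists because the characteristic polynomial has a complex
  root.\<close>

lemma generalized_eigenvector:
  assumes C: "pos_def (Suc m) C" and D: "pos_def (Suc m) D"
  obtains v e where "v \<in> carrier_vec (Suc m)" "v \<noteq> 0\<^sub>v (Suc m)" "C *\<^sub>v v = e \<cdot>\<^sub>v (D *\<^sub>v v)"
proof -
  obtain B where B: "B \<in> carrier_mat (Suc m) (Suc m)" "D * B = 1\<^sub>m (Suc m)"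
    using pos_def_obtain_inverse[OF D] by blast
  have c: "C \<in> carrier_mat (Suc m) (Suc m)" "D \<in> carrier_mat (Suc m) (Suc m)"
    using C D by (auto intro: pos_def_carrier)
  then have BC: "B * C \<in> carrier_mat (Suc m) (Suc m)" using B by simp
  then have "degree (char_poly (B * C)) = Suc m" using degree_monic_char_poly by blast
  then obtain e where "poly (char_poly (B * C)) e = 0"
    using fundamental_theorem_of_algebra[of "char_poly (B * C)"] by (auto simp: constant_degree)
  then have "eigenvalue (B * C) e" using eigenvalue_root_char_poly[OF BC] by simp
  then obtain v where v: "v \<in> carrier_vec (Suc m)" "v \<noteq> 0\<^sub>v (Suc m)" "(B * C) *\<^sub>v v = e \<cdot>\<^sub>v v"
    using BC B unfolding eigenvalue_def eigenvector_def by auto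
  have Cv: "C *\<^sub>v v \<in> carrier_vec (Suc m)" using c v by simp
  have "C *\<^sub>v v = (D * B) *\<^sub>v (C *\<^sub>v v)" unfolding B(2) using Cv by simp
  also have "\<dots> = D *\<^sub>v (B *\<^sub>v (C *\<^sub>v v))"
    by (rule assoc_mult_mat_vec[OF c(2) B(1) Cv])
  also have "B *\<^sub>v (C *\<^sub>v v) = e \<cdot>\<^sub>v v"
    using assoc_mult_mat_vec[OF B(1) c(1) v(1)] v(3) by simp
  also have "D *\<^sub>v (e \<cdot>\<^sub>v v) = e \<cdot>\<^sub>v (D *\<^sub>v v)"
    by (rule mult_mat_vec[OF c(2) v(1)])
  finally show ?thesis using that v by blast
qed

section \<open>Simultaneous diagonalization by congruence\<close>

text \<open>The columns of \<open>N\<close> are an explicit basis of the orthogonal complement of \<open>u\<close>: pick a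
  coordinate \<open>k\<close> with \<open>u\<^sub>k \<noteq> 0\<close> and correct each of the other unit vectors by a multiple of the
  \<open>k\<close>-th one. The rows other than row \<open>k\<close> form an identity matrix, so \<open>N\<close> is injective.\<close>

lemma orthogonal_complement_basis:
  fixes u :: "complex vec"
  assumes u: "u \<in> carrier_vec (Suc m)" "u \<noteq> 0\<^sub>v (Suc m)"
  obtains N where "N \<in> carrier_mat (Suc m) m"
    and "\<And>x. x \<in> carrier_vec m \<Longrightarrow> x \<noteq> 0\<^sub>v m \<Longrightarrow> N *\<^sub>v x \<noteq> 0\<^sub>v (Suc m)"
    and "\<And>x. x \<in> carrier_vec m \<Longrightarrow> (N *\<^sub>v x) \<bullet>c u = 0"
proof -
  obtain k where k: "k < Suc m" "u $ k \<noteq> 0"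
    using u by (metis carrier_vecD eq_vecI index_zero_vec)
  \<comment> \<open>\<open>insert_index k\<close> enumerates the indices other than \<open>k\<close>.\<close>
  let ?s = "insert_index k"
  define N where "N = mat (Suc m) m (\<lambda>(i, j).
    if i = k then - cnj (u $ ?s j) / cnj (u $ k) else if i = ?s j then 1 else 0)"
  have N: "N \<in> carrier_mat (Suc m) m" by (simp add: N_def)
  have s_inj: "?s j = ?s l \<longleftrightarrow> j = l" and s_neq: "?s j \<noteq> k" "k \<noteq> ?s j" for j l
    by (auto simp: insert_index_def split: if_splits)
  have s_lt: "?s j < Suc m" if "j < m" for j
    using that by (auto simp: insert_index_def)
  have s_im: "{..<Suc m} = insert k (?s ` {..<m})"
    using insert_index_image[OF k(1)] k(1) by (auto simp: atLeast0LessThan)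
  have at_s: "(N *\<^sub>v x) $ ?s j = x $ j" if "x \<in> carrier_vec m" "j < m" for x j
  proof -
    have "(N *\<^sub>v x) $ ?s j = (\<Sum>l<m. (if j = l then 1 else 0) * x $ l)"
      using that s_lt[OF that(2)] s_neq s_inj
      by (auto simp: N_def scalar_prod_def atLeast0LessThan intro!: sum.cong)
    also have "\<dots> = x $ j"
      using that by (simp add: if_distrib[of "\<lambda>c. c * _"] cong: if_cong)
    finally show ?thesis .
  qed
  have at_k: "(N *\<^sub>v x) $ k * cnj (u $ k) = - (\<Sum>j<m. x $ j * cnj (u $ ?s j))"
    if "x \<in> carrier_vec m" for x
    using that k
    by (simp add: N_def scalar_prod_def atLeast0LessThan sum_distrib_right mult.commute[of "x $ _"]
        flip: sum_negf)
  show ?thesis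
  proof (rule that[OF N])
    fix x :: "complex vec" assume x: "x \<in> carrier_vec m"
    show "(N *\<^sub>v x) \<bullet>c u = 0"
    proof -
      have "(N *\<^sub>v x) \<bullet>c u = (\<Sum>i<Suc m. (N *\<^sub>v x) $ i * cnj (u $ i))"
        using u N by (auto simp: scalar_prod_def atLeast0LessThan intro!: sum.cong)
      also have "\<dots> = (N *\<^sub>v x) $ k * cnj (u $ k) + (\<Sum>j<m. (N *\<^sub>v x) $ ?s j * cnj (u $ ?s j))"
        unfolding s_im using s_neq s_inj by (subst sum.insert) (auto simp: sum.reindex inj_on_def)
      also have "\<dots> = 0" using at_k[OF x] at_s[OF x] by simp
      finally show ?thesis .
    qed
    assume nz: "x \<noteq> 0\<^sub>v m"
    show "N *\<^sub>v x \<noteq> 0\<^sub>v (Suc m)"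
    proof
      assume "N *\<^sub>v x = 0\<^sub>v (Suc m)"
      then have "x $ j = 0" if "j < m" for j using at_s[OF x that] s_lt[OF that] by simp
      then have "x = 0\<^sub>v m" using x by (intro eq_vecI) auto
      then show False using nz by simp
    qed
  qed
qed

lemma sprod_swap:
  fixes x y :: "complex vec"
  assumes "x \<in> carrier_vec n" "y \<in> carrier_vec n"
  shows "x \<bullet>c y = cnj (y \<bullet>c x)"
  using conjugate_conjugate_sprod[OF assms] conjugate_vec_sprod_comm[OF assms(2,1)]
  by simp

text \<open>Induction on the size. Take \<open>v\<close> with \<open>C v = e D v\<close>, scaled so that its \<open>D\<close>-norm is 1, and let
  the columns of \<open>N\<close> span the \<open>D\<close>-orthogonal complement of \<open>v\<close>. Since \<open>C v\<close> is a multiple of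
  \<open>D v\<close>, this complement is also \<open>C\<close>-orthogonal to \<open>v\<close>, so both forms split. The induction
  hypothesis for the restricted forms \<open>N\<^sup>* C N\<close> and \<open>N\<^sup>* D N\<close> gives \<open>S'\<close>, and \<open>S\<close> consists of
  \<open>v\<close> followed by the columns of \<open>N S'\<close>. For \<open>D\<close> the identity matrix this is the spectral theorem
  for positive definite matrices.\<close>

theorem simultaneous_diagonalization:
  assumes "pos_def m C" "pos_def m D"
  shows "\<exists>S x. S \<in> carrier_mat m m \<and> mat_adjoint S * D * S = 1\<^sub>m m \<and>
    mat_adjoint S * C * S = mat_diag m (\<lambda>i. complex_of_real (x i)) \<and> (\<forall>i<m. x i > 0)"
  using assms
proof (induction m arbitrary: C D)
  case 0
  show ?case
    by (rule exI[of _ "1\<^sub>m 0"], rule exI[of _ "\<lambda>_. 0"])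
      (auto simp: mat_diag_def intro!: eq_matI)
next
  case (Suc m)
  note C = Suc.prems(1) and D = Suc.prems(2)
  have Cc: "C \<in> carrier_mat (Suc m) (Suc m)" and Dc: "D \<in> carrier_mat (Suc m) (Suc m)"
    using C D by (auto intro: pos_def_carrier)
  obtain v0 e where v0: "v0 \<in> carrier_vec (Suc m)" "v0 \<noteq> 0\<^sub>v (Suc m)"
    "C *\<^sub>v v0 = e \<cdot>\<^sub>v (D *\<^sub>v v0)"
    using generalized_eigenvector[OF C D] by blast
  define d where "d = Re ((D *\<^sub>v v0) \<bullet>c v0)"
  have d: "d > 0" "(D *\<^sub>v v0) \<bullet>c v0 = of_real d"
    using pos_def_positive[OF D v0(1,2)] pos_def_form_real[OF D v0(1)] by (auto simp: d_def)
  define c where "c = complex_of_real (1 / sqrt d)"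
  define v where "v = c \<cdot>\<^sub>v v0"
  have v: "v \<in> carrier_vec (Suc m)" using v0(1) by (simp add: v_def)
  have Dv: "D *\<^sub>v v = c \<cdot>\<^sub>v (D *\<^sub>v v0)" and "C *\<^sub>v v = c \<cdot>\<^sub>v (C *\<^sub>v v0)"
    unfolding v_def by (rule mult_mat_vec[OF Dc v0(1)], rule mult_mat_vec[OF Cc v0(1)])
  then have Cv: "C *\<^sub>v v = e \<cdot>\<^sub>v (D *\<^sub>v v)"
    unfolding v0(3) by (simp add: smult_smult_assoc mult.commute)
  have norm: "(D *\<^sub>v v) \<bullet>c v = 1"
  proof -
    have "(D *\<^sub>v v) \<bullet>c v = c * cnj c * ((D *\<^sub>v v0) \<bullet>c v0)"
      unfolding Dv unfolding v_def using v0(1) Dc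
      by (simp add: conjugate_smult_vec)
    also have "c * cnj c = of_real (1 / d)"
      using d(1) unfolding c_def complex_cnj_complex_of_real of_real_mult[symmetric] by simp
    finally show ?thesis using d by simp
  qed
  have Dvc: "D *\<^sub>v v \<in> carrier_vec (Suc m)" using Dc v by simp
  have "D *\<^sub>v v \<noteq> 0\<^sub>v (Suc m)"
  proof
    assume "D *\<^sub>v v = 0\<^sub>v (Suc m)"
    then show False using norm v by simp
  qed
  from orthogonal_complement_basis[OF Dvc this] obtain N where
    N: "N \<in> carrier_mat (Suc m) m"
    and inj: "\<And>x. x \<in> carrier_vec m \<Longrightarrow> x \<noteq> 0\<^sub>v m \<Longrightarrow> N *\<^sub>v x \<noteq> 0\<^sub>v (Suc m)"
    and orth: "\<And>x. x \<in> carrier_vec m \<Longrightarrow> (N *\<^sub>v x) \<bullet>c (D *\<^sub>v v) = 0"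
    by blast
  obtain S' x' where S': "S' \<in> carrier_mat m m"
    and SD: "mat_adjoint S' * (mat_adjoint N * D * N) * S' = 1\<^sub>m m"
    and SC: "mat_adjoint S' * (mat_adjoint N * C * N) * S' = mat_diag m (\<lambda>i. complex_of_real (x' i))"
    and x': "\<And>i. i < m \<Longrightarrow> x' i > 0"
    using Suc.IH[OF pos_def_congruence[OF C N inj] pos_def_congruence[OF D N inj]] by blast
  define S where "S = mat_of_cols (Suc m) (v # map (\<lambda>j. N *\<^sub>v col S' j) [0..<m])"
  have S: "S \<in> carrier_mat (Suc m) (Suc m)" unfolding S_def by (rule carrier_matI) simp_all
  have s: "col S' j \<in> carrier_vec m" for j using S' by auto
  have w: "N *\<^sub>v col S' j \<in> carrier_vec (Suc m)" for j using N s by simp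
  have col0: "col S 0 = v" using v by (simp add: S_def)
  have colS: "col S (Suc j) = N *\<^sub>v col S' j" if "j < m" for j
    using w that by (simp add: S_def)
  \<comment> \<open>Used for \<open>M = D\<close> with \<open>f = 1\<close> and for \<open>M = C\<close> with \<open>f = e\<close>.\<close>
  have entry: "(mat_adjoint S * M * S) $$ (i, j) =
      (case i of 0 \<Rightarrow> (case j of 0 \<Rightarrow> (M *\<^sub>v v) \<bullet>c v | Suc b \<Rightarrow> 0)
        | Suc a \<Rightarrow> (case j of 0 \<Rightarrow> 0
            | Suc b \<Rightarrow> (mat_adjoint S' * (mat_adjoint N * M * N) * S') $$ (a, b)))"
    if M: "pos_def (Suc m) M" and eig: "M *\<^sub>v v = f \<cdot>\<^sub>v (D *\<^sub>v v)" and i: "i < Suc m" and j: "j < Suc m"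
    for M f i j
  proof -
    have Mc: "M \<in> carrier_mat (Suc m) (Suc m)" using M by (rule pos_def_carrier)
    have NMN: "mat_adjoint N * M * N \<in> carrier_mat m m"
      using N Mc by (intro mult_carrier_mat[of _ m "Suc m"]) auto
    have zero: "(M *\<^sub>v v) \<bullet>c (N *\<^sub>v col S' a) = 0" for a
    proof -
      have "(D *\<^sub>v v) \<bullet>c (N *\<^sub>v col S' a) = 0"
        using sprod_swap[OF Dvc w[of a]] orth[OF s, of a] by simp
      then show ?thesis unfolding eig using Dvc w[of a] by simp
    qed
    have zero': "(M *\<^sub>v (N *\<^sub>v col S' a)) \<bullet>c v = 0" for a
      using pos_def_sprod_commute[OF M w[of a] v] zero[of a] by simp
    have e: "(mat_adjoint S * M * S) $$ (i, j) = (M *\<^sub>v col S j) \<bullet>c col S i"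
      by (rule congruence_index[OF Mc S S i j])
    have in_N: "(M *\<^sub>v (N *\<^sub>v col S' b)) \<bullet>c (N *\<^sub>v col S' a) =
        (mat_adjoint S' * (mat_adjoint N * M * N) * S') $$ (a, b)" if "a < m" "b < m" for a b
      unfolding congruence_index[OF NMN S' S' that] congruence_sprod[OF Mc N N s s] ..
    show ?thesis unfolding e using i j zero zero' in_N
      by (cases i; cases j) (simp_all only: nat.case col0 colS Suc_less_eq)
  qed
  let ?x = "\<lambda>i. case i of 0 \<Rightarrow> Re ((C *\<^sub>v v) \<bullet>c v) | Suc a \<Rightarrow> x' a"
  have SS: "mat_adjoint S * M * S \<in> carrier_mat (Suc m) (Suc m)"
    if "M \<in> carrier_mat (Suc m) (Suc m)" for M
    using S that by (intro mult_carrier_mat[of _ "Suc m" "Suc m"]) auto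
  have v_nz: "v \<noteq> 0\<^sub>v (Suc m)" using norm Dvc by auto
  have "mat_adjoint S * D * S = 1\<^sub>m (Suc m)"
  proof (rule eq_matI)
    fix i j assume "i < dim_row (1\<^sub>m (Suc m) :: complex mat)" "j < dim_col (1\<^sub>m (Suc m) :: complex mat)"
    then show "(mat_adjoint S * D * S) $$ (i, j) = 1\<^sub>m (Suc m) $$ (i, j)"
      using entry[OF D, of 1 i j] norm unfolding SD by (auto split: nat.splits)
  qed (use SS[OF Dc] in auto)
  moreover have "mat_adjoint S * C * S = mat_diag (Suc m) (\<lambda>i. complex_of_real (?x i))"
  proof (rule eq_matI)
    fix i j assume "i < dim_row (mat_diag (Suc m) (\<lambda>i. complex_of_real (?x i)))"
      "j < dim_col (mat_diag (Suc m) (\<lambda>i. complex_of_real (?x i)))"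
    then have ij: "i < Suc m" "j < Suc m" by (auto simp: mat_diag_def)
    then show "(mat_adjoint S * C * S) $$ (i, j) = mat_diag (Suc m) (\<lambda>i. complex_of_real (?x i)) $$ (i, j)"
      unfolding entry[OF C Cv ij] SC
      using pos_def_form_real[OF C v] by (auto simp: mat_diag_def split: nat.splits)
  qed (use SS[OF Cc] in \<open>auto simp: mat_diag_def\<close>)
  moreover have "?x i > 0" if "i < Suc m" for i
    using that x' pos_def_positive[OF C v v_nz] by (auto split: nat.splits)
  ultimately show ?case using S by blast
qed

section \<open>Determinants of one plus a real power\<close>

lemma det_mat_diag: "det (mat_diag n f) = (\<Prod>i<n. f i :: complex)"
proof -
  have c: "mat_diag n f \<in> carrier_mat n n" by simp
  have "det (mat_diag n f) = prod_list (diag_mat (mat_diag n f))"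
    by (rule det_upper_triangular[OF _ c]) (auto simp: mat_diag_def upper_triangular_def)
  then show ?thesis by (simp add: prod_list_diag_prod mat_diag_def atLeast0LessThan)
qed

lemma mat_inv_pos_def:
  assumes "pos_def n C"
  shows "mat_inv C \<in> carrier_mat n n" "mat_inv C * C = 1\<^sub>m n"
proof -
  have C: "C \<in> carrier_mat n n" using assms by (rule pos_def_carrier)
  obtain B where "B \<in> carrier_mat n n" "C * B = 1\<^sub>m n" "B * C = 1\<^sub>m n"
    using pos_def_obtain_inverse[OF assms] by blast
  then have "C \<in> Units (ring_mat TYPE(complex) n ())"
    using C unfolding Units_def ring_mat_def by auto
  then obtain B where "mat_inverse C = Some B"
    using mat_inverse(1)[OF C, where b = "()"] by (cases "mat_inverse C") auto
  from mat_inverse(2)[OF C this] this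
  show "mat_inv C \<in> carrier_mat n n" "mat_inv C * C = 1\<^sub>m n"
    by (simp_all add: mat_inv_def)
qed

text \<open>From \<open>S\<^sup>* D S = 1\<close> the matrix \<open>S\<close> has the inverse \<open>T = S\<^sup>* D\<close>. Inverting \<open>S\<^sup>* C S = X\<close>, where
  \<open>X = diag x\<close>, gives \<open>C\<^sup>-\<^sup>1 = S X\<^sup>-\<^sup>1 S\<^sup>*\<close>, hence \<open>C\<^sup>-\<^sup>1 D = S X\<^sup>-\<^sup>1 T\<close>. This is a diagonalization with
  eigenvalues \<open>1 / x\<^sub>i\<close>, so it computes the real power, and the determinant is invariant under the
  similarity.\<close>

lemma det_one_plus_powr:
  assumes C: "pos_def m C" and D: "D \<in> carrier_mat m m" and S: "S \<in> carrier_mat m m"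
    and SD: "mat_adjoint S * D * S = 1\<^sub>m m"
    and SC: "mat_adjoint S * C * S = mat_diag m (\<lambda>i. complex_of_real (x i))"
    and x: "\<And>i. i < m \<Longrightarrow> x i > 0"
  shows "det (1\<^sub>m m + mat_powr (mat_inv C * D) p) = of_real (\<Prod>i<m. 1 + x i powr - p)"
proof -
  define B where "B = mat_inv C"
  have B: "B \<in> carrier_mat m m" "B * C = 1\<^sub>m m"
    using mat_inv_pos_def[OF C] by (simp_all add: B_def)
  have Cc: "C \<in> carrier_mat m m" using C by (rule pos_def_carrier)
  define A where "A = mat_adjoint S"
  have A: "A \<in> carrier_mat m m" using S by (simp add: A_def)
  define T where "T = A * D"
  have T: "T \<in> carrier_mat m m" using A D by (simp add: T_def)
  have TS: "T * S = 1\<^sub>m m" using SD by (simp add: T_def A_def)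
  have ST: "S * T = 1\<^sub>m m" by (rule mat_mult_left_right_inverse[OF T S TS])
  define X where "X = mat_diag m (\<lambda>i. complex_of_real (x i))"
  define Xi where "Xi = mat_diag m (\<lambda>i. complex_of_real (1 / x i))"
  have X: "X \<in> carrier_mat m m" "Xi \<in> carrier_mat m m" by (simp_all add: X_def Xi_def)
  have XXi: "X * Xi = 1\<^sub>m m"
  proof (rule eq_matI)
    fix i j assume "i < dim_row (1\<^sub>m m :: complex mat)" "j < dim_col (1\<^sub>m m :: complex mat)"
    then show "(X * Xi) $$ (i, j) = 1\<^sub>m m $$ (i, j)"
      using x[of j] unfolding X_def Xi_def mat_diag_diag by (auto simp: mat_diag_def)
  qed (use X in auto)
  define A' where "A' = mat_adjoint T"
  have A': "A' \<in> carrier_mat m m" using T by (simp add: A'_def)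
  have AA': "A * A' = 1\<^sub>m m"
    using mat_adjoint_mult[OF T S] TS by (simp add: A_def A'_def)
  have A'A: "A' * A = 1\<^sub>m m" by (rule mat_mult_left_right_inverse[OF A A' AA'])
  note assoc = assoc_mult_mat[of _ m m _ m _ m]
  have "C * S = A' * A * (C * S)" using A'A Cc S by simp
  also have "\<dots> = A' * (A * C * S)" using A' A Cc S by (simp add: assoc)
  also have "A * C * S = X" using SC by (simp add: A_def X_def)
  finally have CS: "C * S = A' * X" .
  have "B * D = B * A' * (A * D)"
  proof -
    have "B * A' * (A * D) = B * (A' * A) * D" using B A' A D by (simp add: assoc)
    then show ?thesis using A'A B by simp
  qed
  also have "B * A' = S * Xi"
  proof -
    have "S * Xi = B * C * (S * Xi)" unfolding B(2) using S X by simp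
    also have "\<dots> = B * (C * S) * Xi" using B(1) Cc S X by (simp add: assoc)
    also have "\<dots> = B * A' * (X * Xi)" unfolding CS using B A' X by (simp add: assoc)
    finally show ?thesis using XXi B A' by simp
  qed
  finally have BD: "B * D = S * Xi * T" by (simp add: T_def)
  have BDc: "B * D \<in> carrier_mat m m" using B D by simp
  define Y where "Y = mat_diag m (\<lambda>i. complex_of_real ((1 / x i) powr p))"
  have Y: "Y \<in> carrier_mat m m" by (simp add: Y_def)
  have "is_real_power (B * D) p (S * Y * T)"
    unfolding is_real_power_def
    by (rule exI[of _ S], rule exI[of _ T], rule exI[of _ "\<lambda>i. 1 / x i"])
      (use BDc BD S T ST TS X x in \<open>simp_all add: similar_mat_wit_def Let_def Xi_def Y_def\<close>)
  then have pw: "mat_powr (B * D) p = S * Y * T" by (rule mat_powr_eqI)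
  have "1\<^sub>m m + S * Y * T = S * (1\<^sub>m m + Y) * T"
  proof -
    have "S * (1\<^sub>m m + Y) * T = (S * 1\<^sub>m m + S * Y) * T"
      by (simp only: mult_add_distrib_mat[OF S one_carrier_mat Y])
    also have "\<dots> = S * 1\<^sub>m m * T + S * Y * T"
      using S T Y by (intro add_mult_distrib_mat[of _ m m]) auto
    finally show ?thesis using S ST by simp
  qed
  then have "det (1\<^sub>m m + mat_powr (B * D) p) = det S * det (1\<^sub>m m + Y) * det T"
    unfolding pw using S T Y by (simp add: det_mult[of _ m])
  also have "\<dots> = det (1\<^sub>m m + Y) * det (S * T)"
    using S T by (simp add: det_mult[of _ m])
  also have "\<dots> = det (1\<^sub>m m + Y)" by (simp add: ST)
  also have "1\<^sub>m m + Y = mat_diag m (\<lambda>i. complex_of_real (1 + (1 / x i) powr p))"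
    unfolding Y_def mat_diag_one[symmetric] by (rule eq_matI) (auto simp: mat_diag_def)
  also have "det \<dots> = of_real (\<Prod>i<m. 1 + (1 / x i) powr p)"
    unfolding det_mat_diag by simp
  also have "(\<Prod>i<m. 1 + (1 / x i) powr p) = (\<Prod>i<m. 1 + x i powr - p)"
    using x by (intro prod.cong) (auto simp: powr_minus_divide powr_divide)
  finally show ?thesis by (simp add: B_def)
qed

section \<open>Diagonal entries and eigenvalues\<close>

lemma mat_diag_sprod:
  assumes "w \<in> carrier_vec n"
  shows "(mat_diag n f *\<^sub>v w) \<bullet>c w = (\<Sum>j<n. f j * complex_of_real ((cmod (w $ j))\<^sup>2))"
proof -
  have "(mat_diag n f *\<^sub>v w) $ j = f j * w $ j" if "j < n" for j
  proof -
    have "(mat_diag n f *\<^sub>v w) $ j = (\<Sum>i<n. (if j = i then f i else 0) * w $ i)"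
      using that assms by (auto simp: mat_diag_def scalar_prod_def atLeast0LessThan intro!: sum.cong)
    also have "\<dots> = f j * w $ j" using that by (simp add: if_distrib[of "\<lambda>c. c * _"] cong: if_cong)
    finally show ?thesis .
  qed
  then have "(mat_diag n f *\<^sub>v w) \<bullet>c w = (\<Sum>j<n. f j * w $ j * cnj (w $ j))"
    using assms by (auto simp: scalar_prod_def[of _ "conjugate w"] atLeast0LessThan intro!: sum.cong)
  then show ?thesis by (simp only: mult.assoc complex_norm_square)
qed

text \<open>Schur's observation: the diagonal entries of \<open>W\<^sup>* diag(l) W\<close> are averages of the numbers
  \<open>l\<^sub>j\<close> with weights \<open>|W\<^sub>j\<^sub>i|\<^sup>2\<close>. The weights are doubly stochastic since \<open>W\<close> is unitary: the
  sum over \<open>j\<close> being 1 makes Jensen's inequality applicable to each diagonal entry, and the sum over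
  \<open>i\<close> being 1 makes each \<open>f (l\<^sub>j)\<close> occur with total weight 1 in the sum of the bounds.\<close>

lemma unitary_congruence_trace_convex:
  fixes W :: "complex mat" and l :: "nat \<Rightarrow> real"
  assumes W: "W \<in> carrier_mat n n" and WW: "mat_adjoint W * W = 1\<^sub>m n"
    and f: "convex_on A f" and l: "\<And>j. j < n \<Longrightarrow> l j \<in> A"
  defines "E \<equiv> mat_adjoint W * mat_diag n (\<lambda>j. complex_of_real (l j)) * W"
  shows "(\<Sum>i<n. f (Re (E $$ (i, i)))) \<le> (\<Sum>j<n. f (l j))"
proof (cases "n = 0")
  case False
  define a where "a i j = (cmod (W $$ (j, i)))\<^sup>2" for i j
  have aW: "mat_adjoint W \<in> carrier_mat n n" using W by simp
  have WW': "W * mat_adjoint W = 1\<^sub>m n" by (rule mat_mult_left_right_inverse[OF aW W WW])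
  have E: "E $$ (i, i) = of_real (\<Sum>j<n. a i j * l j)" if "i < n" for i
  proof -
    have "E $$ (i, i) = (\<Sum>j<n. of_real (l j) * complex_of_real ((cmod (col W i $ j))\<^sup>2))"
      unfolding E_def congruence_index[OF mat_diag_dim W W that that]
      by (rule mat_diag_sprod) (use W in auto)
    also have "\<dots> = of_real (\<Sum>j<n. a i j * l j)"
      using W that by (simp add: a_def mult.commute)
    finally show ?thesis .
  qed
  have unit: "(\<Sum>j<n. (cmod (V $$ (j, i)))\<^sup>2) = 1"
    if V: "V \<in> carrier_mat n n" "mat_adjoint V * V = 1\<^sub>m n" and i: "i < n" for V i
  proof -
    have "complex_of_real (\<Sum>j<n. (cmod (V $$ (j, i)))\<^sup>2) = (mat_adjoint V * V) $$ (i, i)"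
      using V(1) i by (simp add: scalar_prod_def atLeast0LessThan complex_norm_square[unfolded of_real_power]
          mult.commute)
    then show ?thesis using V(2) i by (simp del: of_real_sum)
  qed
  have rows: "(\<Sum>j<n. a i j) = 1" if "i < n" for i
    using unit[OF W WW that] by (simp add: a_def)
  have cols: "(\<Sum>i<n. a i j) = 1" if "j < n" for j
    using unit[OF aW _ that] WW' W that by (simp add: a_def)
  have "(\<Sum>i<n. f (Re (E $$ (i, i)))) \<le> (\<Sum>i<n. \<Sum>j<n. a i j * f (l j))"
  proof (rule sum_mono)
    fix i assume "i \<in> {..<n}"
    then have i: "i < n" by simp
    have "f (\<Sum>j<n. a i j *\<^sub>R l j) \<le> (\<Sum>j<n. a i j * f (l j))"
      by (rule convex_on_sum[OF _ _ f rows[OF i]]) (use False l in \<open>auto simp: a_def\<close>)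
    then show "f (Re (E $$ (i, i))) \<le> (\<Sum>j<n. a i j * f (l j))"
      by (simp add: E[OF i])
  qed
  also have "\<dots> = (\<Sum>j<n. (\<Sum>i<n. a i j) * f (l j))"
    by (subst sum.swap) (simp add: sum_distrib_right)
  also have "\<dots> = (\<Sum>j<n. f (l j))" by (simp add: cols)
  finally show ?thesis .
qed simp

text \<open>The derivative, written as \<open>- p / (t\<^sup>p\<^sup>+\<^sup>1 + t)\<close>, is visibly increasing on the positive
  reals when \<open>p \<ge> 0\<close>.\<close>

lemma convex_ln_one_plus_powr:
  assumes "p \<ge> 0"
  shows "convex_on {0<..} (\<lambda>t::real. ln (1 + t powr - p))"
proof (rule convex_on_realI)
  fix t :: real assume "t \<in> {0<..}"
  then have t: "t > 0" by simp
  have pos: "1 + t powr - p > 0" by (simp add: add_pos_nonneg)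
  have "((\<lambda>t. ln (1 + t powr - p)) has_real_derivative
      (- p * t powr (- p - 1)) / (1 + t powr - p)) (at t)"
    using t pos by (auto intro!: derivative_eq_intros)
  also have "(- p * t powr (- p - 1)) / (1 + t powr - p) = - p / (t powr (p + 1) + t)"
  proof -
    have "(1 + t powr - p) = t powr (- p - 1) * (t powr (p + 1) + t)"
      using t by (simp add: distrib_left powr_add[symmetric] powr_mult_base mult.commute)
    then show ?thesis using t by simp
  qed
  finally show "((\<lambda>t. ln (1 + t powr - p)) has_real_derivative - p / (t powr (p + 1) + t)) (at t)" .
next
  fix s t :: real assume "s \<in> {0<..}" "t \<in> {0<..}" "s \<le> t"
  then have st: "0 < s" "s \<le> t" by auto
  have "s powr (p + 1) \<le> t powr (p + 1)" using st assms by (intro powr_mono2) auto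
  moreover have "s powr (p + 1) > 0" using st by simp
  ultimately show "- p / (s powr (p + 1) + s) \<le> - p / (t powr (p + 1) + t)"
    using st assms by (simp add: frac_le add_mono add_pos_pos)
qed simp

section \<open>Block coordinates\<close>

text \<open>Every index below \<open>offset ns k\<close> is \<open>offset ns i + a\<close> for exactly one block \<open>i < k\<close> and one
  position \<open>a < ns i\<close> inside it. The next lemmas allow matrices and products to be read in these
  coordinates.\<close>

abbreviation (input) offset :: "(nat \<Rightarrow> nat) \<Rightarrow> nat \<Rightarrow> nat" where
  "offset ns i \<equiv> (\<Sum>j<i. ns j)"

lemma offset_less:
  assumes "i < k" "a < ns i"
  shows "offset ns i + a < offset ns k"
proof -
  have "offset ns i + a < offset ns (Suc i)" using assms by simp
  also have "\<dots> \<le> offset ns k" using assms by (intro sum_mono2) auto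
  finally show ?thesis .
qed

lemma offset_inject:
  assumes "a < ns i" "b < ns j"
  shows "offset ns i + a = offset ns j + b \<longleftrightarrow> i = j \<and> a = b"
  using offset_less[where i = i and k = j and a = a and ns = ns]
    offset_less[where i = j and k = i and a = b and ns = ns] assms
  by (cases i j rule: linorder_cases) auto

lemma offset_cases:
  assumes "r < offset ns k"
  obtains i a where "i < k" "a < ns i" "r = offset ns i + a"
proof -
  have "\<exists>i<k. \<exists>a<ns i. r = offset ns i + a"
    using assms
  proof (induction k)
    case (Suc k)
    show ?case
    proof (cases "r < offset ns k")
      case True
      then show ?thesis using Suc.IH less_SucI by metis
    next
      case False
      with Suc.prems have "r = offset ns k + (r - offset ns k)" "r - offset ns k < ns k" by auto
      then show ?thesis by blast
    qed
  qed simp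
  then show ?thesis using that by blast
qed

lemma prod_over_blocks:
  fixes f :: "nat \<Rightarrow> 'a :: comm_monoid_mult"
  shows "(\<Prod>r<offset ns k. f r) = (\<Prod>i<k. \<Prod>a<ns i. f (offset ns i + a))"
proof (induction k)
  case (Suc k)
  have "(\<Prod>r<m + l. f r) = (\<Prod>r<m. f r) * (\<Prod>a<l. f (m + a))" for m l :: nat
    by (induction l) (auto simp: mult.assoc)
  then show ?case by (simp add: Suc)
qed simp

lemma diag_block_mat_offset:
  assumes "\<And>i. i < k \<Longrightarrow> As i \<in> carrier_mat (ns i) (ns i)"
  defines "B \<equiv> diag_block_mat (map As [0..<k])"
  shows "B \<in> carrier_mat (offset ns k) (offset ns k)"
    and "\<And>i j a b. i < k \<Longrightarrow> j < k \<Longrightarrow> a < ns i \<Longrightarrow> b < ns j \<Longrightarrow>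
      B $$ (offset ns i + a, offset ns j + b) = (if i = j then As i $$ (a, b) else 0)"
proof -
  have "diag_block_mat (map As [0..<k]) \<in> carrier_mat (offset ns k) (offset ns k) \<and>
    (\<forall>i<k. \<forall>j<k. \<forall>a<ns i. \<forall>b<ns j.
      diag_block_mat (map As [0..<k]) $$ (offset ns i + a, offset ns j + b) =
        (if i = j then As i $$ (a, b) else 0))"
    using assms(1)
  proof (induction k)
    case (Suc k)
    define A where "A = diag_block_mat (map As [0..<k])"
    define m where "m = offset ns k"
    have A: "A \<in> carrier_mat m m"
      and ent: "\<And>i j a b. i < k \<Longrightarrow> j < k \<Longrightarrow> a < ns i \<Longrightarrow> b < ns j \<Longrightarrow>
        A $$ (offset ns i + a, offset ns j + b) = (if i = j then As i $$ (a, b) else 0)"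
      using Suc by (auto simp: A_def m_def)
    have Ak: "As k \<in> carrier_mat (ns k) (ns k)" using Suc.prems by simp
    have eq: "diag_block_mat (map As [0..<Suc k]) =
        four_block_mat A (0\<^sub>m m (ns k)) (0\<^sub>m (ns k) m) (As k)"
      using A Ak by (simp add: diag_block_mat_last Let_def A_def)
    have m: "offset ns (Suc k) = m + ns k" by (simp add: m_def)
    show ?case
      unfolding eq m
    proof (intro conjI allI impI)
      show "four_block_mat A (0\<^sub>m m (ns k)) (0\<^sub>m (ns k) m) (As k) \<in> carrier_mat (m + ns k) (m + ns k)"
        using A Ak by (intro four_block_carrier_mat)
      fix i j a b assume ij: "i < Suc k" "j < Suc k" and ab: "a < ns i" "b < ns j"
      have less: "offset ns i + a < m" if "i < k" "a < ns i" for i a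
        unfolding m_def using that by (rule offset_less)
      show "four_block_mat A (0\<^sub>m m (ns k)) (0\<^sub>m (ns k) m) (As k) $$
          (offset ns i + a, offset ns j + b) = (if i = j then As i $$ (a, b) else 0)"
        using ij ab A Ak less[of i a] less[of j b] ent[of i j a b]
        by (cases "i = k"; cases "j = k") (auto simp: m_def)
    qed
  qed auto
  then show "B \<in> carrier_mat (offset ns k) (offset ns k)"
    and "\<And>i j a b. i < k \<Longrightarrow> j < k \<Longrightarrow> a < ns i \<Longrightarrow> b < ns j \<Longrightarrow>
      B $$ (offset ns i + a, offset ns j + b) = (if i = j then As i $$ (a, b) else 0)"
    unfolding B_def by blast+
qed

text \<open>The inclusion of the \<open>i\<close>-th summand of \<open>\<complex>\<^sup>n\<close>. With it, the block of \<open>M\<close> in block row \<open>i\<close> and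
  block column \<open>j\<close> is a congruence in the sense above.\<close>

definition block_embed :: "(nat \<Rightarrow> nat) \<Rightarrow> nat \<Rightarrow> nat \<Rightarrow> complex mat" where
  "block_embed ns n i = mat n (ns i) (\<lambda>(r, a). if r = offset ns i + a then 1 else 0)"

lemma block_embed_carrier [simp]: "block_embed ns n i \<in> carrier_mat n (ns i)"
  by (simp add: block_embed_def)

lemma block_embed_index:
  assumes "x \<in> carrier_vec (ns i)" "i < k" "j < k" "b < ns j"
  shows "(block_embed ns (offset ns k) i *\<^sub>v x) $ (offset ns j + b) = (if i = j then x $ b else 0)"
proof -
  have "(block_embed ns (offset ns k) i *\<^sub>v x) $ (offset ns j + b) =
      (\<Sum>a<ns i. if j = i \<and> b = a then x $ a else 0)"
    using assms offset_less[of j k b ns]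
    by (auto simp: block_embed_def scalar_prod_def atLeast0LessThan offset_inject intro!: sum.cong)
  also have "\<dots> = (if i = j then x $ b else 0)" using assms by auto
  finally show ?thesis .
qed

lemma block_embed_inj:
  assumes "i < k" "x \<in> carrier_vec (ns i)" "x \<noteq> 0\<^sub>v (ns i)"
  shows "block_embed ns (offset ns k) i *\<^sub>v x \<noteq> 0\<^sub>v (offset ns k)"
proof
  assume "block_embed ns (offset ns k) i *\<^sub>v x = 0\<^sub>v (offset ns k)"
  then have "x $ a = 0" if "a < ns i" for a
    using block_embed_index[where ns = ns, OF assms(2) assms(1) assms(1) that] offset_less[where ns = ns, OF assms(1) that] by simp
  then have "x = 0\<^sub>v (ns i)" using assms by (intro eq_vecI) auto
  then show False using assms by simp
qed

lemma block_embed_congruence_index: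
  assumes M: "M \<in> carrier_mat (offset ns k) (offset ns k)" and ij: "i < k" "j < k" and ab: "a < ns i" "b < ns j"
  shows "(mat_adjoint (block_embed ns (offset ns k) i) * M * block_embed ns (offset ns k) j) $$ (a, b) =
    M $$ (offset ns i + a, offset ns j + b)"
proof -
  have col: "col (block_embed ns (offset ns k) i) a = unit_vec (offset ns k) (offset ns i + a)"
    if "i < k" "a < ns i" for i a
    using that offset_less[where ns = ns, OF that] by (intro eq_vecI) (auto simp: block_embed_def unit_vec_def)
  show ?thesis
    unfolding congruence_index[OF M block_embed_carrier[where ns = ns] block_embed_carrier[where ns = ns] ab]
      index_eq_sprod[OF M offset_less[where ns = ns, OF ij(1) ab(1)] offset_less[where ns = ns, OF ij(2) ab(2)]]
    using ij ab by (simp add: col)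
qed

lemma block_embed_congruence:
  assumes "M \<in> carrier_mat (offset ns k) (offset ns k)" "i < k"
  shows "mat_adjoint (block_embed ns (offset ns k) i) * M * block_embed ns (offset ns k) i = diag_block ns M i"
proof (rule eq_matI)
  fix a b assume "a < dim_row (diag_block ns M i)" "b < dim_col (diag_block ns M i)"
  then have ab: "a < ns i" "b < ns i" by (simp_all add: diag_block_def)
  then show "(mat_adjoint (block_embed ns (offset ns k) i) * M * block_embed ns (offset ns k) i) $$ (a, b) =
      diag_block ns M i $$ (a, b)"
    unfolding block_embed_congruence_index[OF assms(1,2,2) ab] by (simp add: diag_block_def)
qed (simp_all add: diag_block_def block_embed_def)

lemma diag_block_pos_def:
  assumes "pos_def (offset ns k) C" "i < k"
  shows "pos_def (ns i) (diag_block ns C i)"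
  using pos_def_congruence[OF assms(1) block_embed_carrier[where ns = ns] block_embed_inj[where ns = ns, OF assms(2)]]
  unfolding block_embed_congruence[OF pos_def_carrier[OF assms(1)] assms(2)] .

lemma col_diag_block_mat:
  assumes Ss: "\<And>i. i < k \<Longrightarrow> Ss i \<in> carrier_mat (ns i) (ns i)" and i: "i < k" and a: "a < ns i"
  shows "col (diag_block_mat (map Ss [0..<k])) (offset ns i + a) =
    block_embed ns (offset ns k) i *\<^sub>v col (Ss i) a"
proof (rule eq_vecI)
  fix r assume "r < dim_vec (block_embed ns (offset ns k) i *\<^sub>v col (Ss i) a)"
  then have "r < offset ns k" by (simp add: block_embed_def)
  then obtain j b where jb: "j < k" "b < ns j" "r = offset ns j + b" by (rule offset_cases)
  have c: "col (Ss i) a \<in> carrier_vec (ns i)" using Ss[OF i] a by simp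
  have S: "diag_block_mat (map Ss [0..<k]) \<in> carrier_mat (offset ns k) (offset ns k)"
    using Ss by (rule diag_block_mat_offset(1))
  have S_index: "diag_block_mat (map Ss [0..<k]) $$ (offset ns j + b, offset ns i + a) =
      (if j = i then Ss j $$ (b, a) else 0)"
    using Ss jb(1) i jb(2) a by (rule diag_block_mat_offset(2))
  show "col (diag_block_mat (map Ss [0..<k])) (offset ns i + a) $ r =
      (block_embed ns (offset ns k) i *\<^sub>v col (Ss i) a) $ r"
    using S S_index offset_less[where ns = ns, OF i a] offset_less[where ns = ns, OF jb(1,2)] Ss[OF i] a jb(2)
    unfolding jb(3) block_embed_index[OF c i jb(1,2)] by auto
next
  have "diag_block_mat (map Ss [0..<k]) \<in> carrier_mat (offset ns k) (offset ns k)"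
    using Ss by (rule diag_block_mat_offset(1))
  then show "dim_vec (col (diag_block_mat (map Ss [0..<k])) (offset ns i + a)) =
      dim_vec (block_embed ns (offset ns k) i *\<^sub>v col (Ss i) a)"
    by (simp add: block_embed_def)
qed

text \<open>A congruence by a block diagonal matrix acts on each block separately. The reason is that the
  columns of \<open>S\<close> belonging to block \<open>i\<close> are the columns of \<open>Ss i\<close> included into the full space.\<close>

lemma block_diag_congruence_index:
  fixes Ss :: "nat \<Rightarrow> complex mat"
  assumes Ss: "\<And>i. i < k \<Longrightarrow> Ss i \<in> carrier_mat (ns i) (ns i)"
    and M: "M \<in> carrier_mat (offset ns k) (offset ns k)"
    and ij: "i < k" "j < k" and ab: "a < ns i" "b < ns j"
  defines "S \<equiv> diag_block_mat (map Ss [0..<k])"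
  shows "(mat_adjoint S * M * S) $$ (offset ns i + a, offset ns j + b) =
    (mat_adjoint (Ss i) * (mat_adjoint (block_embed ns (offset ns k) i) * M *
      block_embed ns (offset ns k) j) * Ss j) $$ (a, b)"
proof -
  have S: "S \<in> carrier_mat (offset ns k) (offset ns k)"
    unfolding S_def using Ss by (rule diag_block_mat_offset(1))
  have col: "col (Ss i) a \<in> carrier_vec (ns i)" "col (Ss j) b \<in> carrier_vec (ns j)"
    using Ss[OF ij(1)] Ss[OF ij(2)] ab by simp_all
  have c: "mat_adjoint (block_embed ns (offset ns k) i) * M * block_embed ns (offset ns k) j
      \<in> carrier_mat (ns i) (ns j)"
    using M by (intro mult_carrier_mat[of _ "ns i" "offset ns k"]) auto
  have S_col: "col S (offset ns i + a) = block_embed ns (offset ns k) i *\<^sub>v col (Ss i) a"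
    if "i < k" "a < ns i" for i a
    unfolding S_def using Ss that by (rule col_diag_block_mat)
  have "(mat_adjoint S * M * S) $$ (offset ns i + a, offset ns j + b) =
      (M *\<^sub>v (block_embed ns (offset ns k) j *\<^sub>v col (Ss j) b)) \<bullet>c
      (block_embed ns (offset ns k) i *\<^sub>v col (Ss i) a)"
    unfolding congruence_index[OF M S S offset_less[where ns = ns, OF ij(1) ab(1)] offset_less[where ns = ns, OF ij(2) ab(2)]]
    unfolding S_col[OF ij(1) ab(1)] S_col[OF ij(2) ab(2)] ..
  also have "\<dots> = (mat_adjoint (Ss i) * (mat_adjoint (block_embed ns (offset ns k) i) * M *
      block_embed ns (offset ns k) j) * Ss j) $$ (a, b)"
    unfolding congruence_index[OF c Ss[OF ij(1)] Ss[OF ij(2)] ab]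
      congruence_sprod[OF M block_embed_carrier[where ns = ns] block_embed_carrier[where ns = ns] col] ..
  finally show ?thesis .
qed

section \<open>The determinantal inequality\<close>

theorem theorem2p6:
  fixes k n :: nat and ns :: "nat \<Rightarrow> nat"
    and C D :: "complex mat" and Ds :: "nat \<Rightarrow> complex mat" and p :: real
  assumes "k \<ge> 1"
    and "\<And>i. i < k \<Longrightarrow> ns i \<ge> 1"
    and "(\<Sum>i<k. ns i) = n"
    and "pos_def n C"
    and "\<And>i. i < k \<Longrightarrow> pos_def (ns i) (Ds i)"
    and "D = diag_block_mat (map Ds [0..<k])"
    and "p \<ge> 0"
  shows "let L = (\<Prod>i<k. Determinant.det
                   (1\<^sub>m (ns i) + mat_powr (mat_inv (diag_block ns C i) * Ds i) p));
             R = Determinant.det (1\<^sub>m n + mat_powr (mat_inv C * D) p)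
         in L \<in> \<real> \<and> R \<in> \<real> \<and> Re L \<le> Re R"
proof -
  have n: "n = offset ns k" using assms(3) by simp
  have C: "pos_def (offset ns k) C" using assms(4) by (simp add: n)
  have Cc: "C \<in> carrier_mat (offset ns k) (offset ns k)" using C by (rule pos_def_carrier)
  have Dsc: "Ds i \<in> carrier_mat (ns i) (ns i)" if "i < k" for i
    using assms(5)[OF that] by (rule pos_def_carrier)
  have D: "D \<in> carrier_mat (offset ns k) (offset ns k)"
    unfolding assms(6) using Dsc by (rule diag_block_mat_offset(1))
  have D_index: "D $$ (offset ns i + a, offset ns j + b) = (if i = j then Ds i $$ (a, b) else 0)"
    if "i < k" "j < k" "a < ns i" "b < ns j" for i j a b
    unfolding assms(6) using Dsc that by (rule diag_block_mat_offset(2))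
  have "\<forall>i. \<exists>S x. i < k \<longrightarrow> S \<in> carrier_mat (ns i) (ns i) \<and>
      mat_adjoint S * Ds i * S = 1\<^sub>m (ns i) \<and>
      mat_adjoint S * diag_block ns C i * S = mat_diag (ns i) (\<lambda>a. complex_of_real (x a)) \<and>
      (\<forall>a<ns i. x a > 0)"
    using simultaneous_diagonalization[OF diag_block_pos_def[OF C] assms(5)] by blast
  then obtain Ss x where Ss_x: "\<forall>i. i < k \<longrightarrow> Ss i \<in> carrier_mat (ns i) (ns i) \<and>
      mat_adjoint (Ss i) * Ds i * Ss i = 1\<^sub>m (ns i) \<and>
      mat_adjoint (Ss i) * diag_block ns C i * Ss i
        = mat_diag (ns i) (\<lambda>a. complex_of_real (x i a)) \<and>
      (\<forall>a<ns i. x i a > 0)"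
    unfolding choice_iff by (elim exE)
  have Ss: "Ss i \<in> carrier_mat (ns i) (ns i)"
    and SsD: "mat_adjoint (Ss i) * Ds i * Ss i = 1\<^sub>m (ns i)"
    and SsC: "mat_adjoint (Ss i) * diag_block ns C i * Ss i
        = mat_diag (ns i) (\<lambda>a. complex_of_real (x i a))"
    and x: "\<And>a. a < ns i \<Longrightarrow> x i a > 0" if "i < k" for i
    using Ss_x that by blast+
  \<comment> \<open>The block numbers \<open>x i a\<close> are the diagonal entries of \<open>E = S\<^sup>* C S\<close>, whereas \<open>S\<^sup>* D S = 1\<close>.\<close>
  define S where "S = diag_block_mat (map Ss [0..<k])"
  have S: "S \<in> carrier_mat n n" unfolding S_def n using Ss by (rule diag_block_mat_offset(1))
  have aS: "mat_adjoint S \<in> carrier_mat n n" using S by simp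
  note C_n = Cc[folded n] and D_n = D[folded n]
  have SDc: "mat_adjoint S * D \<in> carrier_mat n n" using aS D_n by (rule mult_carrier_mat)
  have SD: "mat_adjoint S * D * S = 1\<^sub>m n"
  proof (rule eq_matI)
    fix r s assume "r < dim_row (1\<^sub>m n :: complex mat)" "s < dim_col (1\<^sub>m n :: complex mat)"
    then have rs: "r < offset ns k" "s < offset ns k" by (simp_all add: n)
    obtain i a where ia: "i < k" "a < ns i" "r = offset ns i + a" using offset_cases[OF rs(1)] .
    obtain j b where jb: "j < k" "b < ns j" "s = offset ns j + b" using offset_cases[OF rs(2)] .
    let ?M = "mat_adjoint (block_embed ns (offset ns k) i) * D * block_embed ns (offset ns k) j"
    have M: "?M = (if i = j then Ds i else 0\<^sub>m (ns i) (ns j))"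
    proof (rule eq_matI)
      fix a b
      assume "a < dim_row (if i = j then Ds i else 0\<^sub>m (ns i) (ns j))"
        "b < dim_col (if i = j then Ds i else 0\<^sub>m (ns i) (ns j))"
      then have "a < ns i" "b < ns j" using Dsc[OF ia(1)] by (auto split: if_splits)
      then show "?M $$ (a, b) = (if i = j then Ds i else 0\<^sub>m (ns i) (ns j)) $$ (a, b)"
        unfolding block_embed_congruence_index[OF D ia(1) jb(1) \<open>a < ns i\<close> \<open>b < ns j\<close>]
        using D_index[OF ia(1) jb(1)] by simp
    qed (use Dsc[OF ia(1)] in \<open>auto simp: block_embed_def\<close>)
    have "(mat_adjoint S * D * S) $$ (r, s) = (mat_adjoint (Ss i) * ?M * Ss j) $$ (a, b)"
      unfolding S_def ia(3) jb(3)
      using Ss D ia(1) jb(1) ia(2) jb(2) by (rule block_diag_congruence_index)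
    also have "\<dots> = (if i = j \<and> a = b then 1 else 0)"
    proof (cases "i = j")
      case True
      then show ?thesis unfolding M using SsD[OF ia(1)] ia(2) jb(2) by simp
    next
      case False
      have "mat_adjoint (Ss i) * 0\<^sub>m (ns i) (ns j) * Ss j = 0\<^sub>m (ns i) (ns j)"
        using Ss[OF ia(1)] Ss[OF jb(1)] by simp
      then show ?thesis unfolding M using False ia(2) jb(2) by simp
    qed
    also have "\<dots> = 1\<^sub>m n $$ (r, s)"
      using rs offset_inject[where ns = ns, OF ia(2) jb(2)] by (simp add: n ia(3) jb(3))
    finally show "(mat_adjoint S * D * S) $$ (r, s) = 1\<^sub>m n $$ (r, s)" .
  qed (use S in auto)
  define E where "E = mat_adjoint S * C * S"
  have E_diag: "E $$ (offset ns i + a, offset ns i + a) = of_real (x i a)" if ia: "i < k" "a < ns i" for i a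
  proof -
    have "E $$ (offset ns i + a, offset ns i + a) =
        (mat_adjoint (Ss i) * diag_block ns C i * Ss i) $$ (a, a)"
      unfolding E_def S_def block_embed_congruence[OF Cc ia(1), symmetric]
      using Ss Cc ia(1) ia(1) ia(2) ia(2) by (rule block_diag_congruence_index)
    then show ?thesis using SsC[OF ia(1)] ia(2) by (simp add: mat_diag_def)
  qed
  have "S *\<^sub>v v \<noteq> 0\<^sub>v n" if v: "v \<in> carrier_vec n" "v \<noteq> 0\<^sub>v n" for v
  proof
    assume "S *\<^sub>v v = 0\<^sub>v n"
    moreover have "M *\<^sub>v 0\<^sub>v n = 0\<^sub>v n" if "M \<in> carrier_mat n n" for M :: "complex mat"
      using that by (intro eq_vecI) auto
    ultimately have "(mat_adjoint S * D) *\<^sub>v (S *\<^sub>v v) = 0\<^sub>v n"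
      using SDc by (simp only:)
    moreover have "(mat_adjoint S * D) *\<^sub>v (S *\<^sub>v v) = v"
      unfolding assoc_mult_mat_vec[OF SDc S v(1), symmetric] SD using v(1) by simp
    ultimately show False using v(2) by simp
  qed
  then have E: "pos_def n E" unfolding E_def by (rule pos_def_congruence[OF assms(4) S])
  have Ec: "E \<in> carrier_mat n n" using E by (rule pos_def_carrier)
  obtain W l where W: "W \<in> carrier_mat n n" and WW: "mat_adjoint W * 1\<^sub>m n * W = 1\<^sub>m n"
    and WE: "mat_adjoint W * E * W = mat_diag n (\<lambda>i. complex_of_real (l i))"
    and l: "\<And>i. i < n \<Longrightarrow> l i > 0"
    using simultaneous_diagonalization[OF E pos_def_one] by blast
  have aW: "mat_adjoint W \<in> carrier_mat n n" using W by simp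
  have W1: "mat_adjoint W * W = 1\<^sub>m n" using WW unfolding right_mult_one_mat[OF aW] .
  have W2: "W * mat_adjoint W = 1\<^sub>m n" by (rule mat_mult_left_right_inverse[OF aW W W1])
  note assoc = assoc_mult_mat[of _ n n _ n _ n]
  \<comment> \<open>\<open>W\<close> is unitary, so \<open>S W\<close> diagonalizes the pair \<open>(C, D)\<close> with the eigenvalues of \<open>E\<close>.\<close>
  have SW: "S * W \<in> carrier_mat n n" using S W by simp
  have conj_SW: "mat_adjoint (S * W) * M * (S * W) = mat_adjoint W * (mat_adjoint S * M * S) * W"
    if "M \<in> carrier_mat n n" for M
    unfolding mat_adjoint_mult[OF S W] using that S W aS aW
    by (simp add: assoc mult_carrier_mat[of _ n n])
  have "mat_adjoint (S * W) * D * (S * W) = 1\<^sub>m n"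
    unfolding conj_SW[OF D_n] SD by (rule WW)
  moreover have "mat_adjoint (S * W) * C * (S * W) = mat_diag n (\<lambda>i. complex_of_real (l i))"
    unfolding conj_SW[OF C_n] E_def[symmetric] by (rule WE)
  ultimately have R: "det (1\<^sub>m n + mat_powr (mat_inv C * D) p) = of_real (\<Prod>r<n. 1 + l r powr - p)"
    by (rule det_one_plus_powr[OF assms(4) D_n SW]) (rule l)
  have L: "(\<Prod>i<k. det (1\<^sub>m (ns i) + mat_powr (mat_inv (diag_block ns C i) * Ds i) p)) =
      of_real (\<Prod>i<k. \<Prod>a<ns i. 1 + x i a powr - p)"
    unfolding of_real_prod
  proof (rule prod.cong[OF refl])
    fix i assume "i \<in> {..<k}"
    then have i: "i < k" by simp
    show "det (1\<^sub>m (ns i) + mat_powr (mat_inv (diag_block ns C i) * Ds i) p) =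
        (\<Prod>a<ns i. of_real (1 + x i a powr - p))"
      unfolding of_real_prod[symmetric]
      by (rule det_one_plus_powr[OF diag_block_pos_def[OF C i] Dsc[OF i] Ss[OF i] SsD[OF i] SsC[OF i] x[OF i]])
  qed
  \<comment> \<open>The diagonal of \<open>E\<close> carries the left side, its eigenvalues \<open>l\<close> the right side.\<close>
  define y where "y r = Re (E $$ (r, r))" for r
  have y: "y (offset ns i + a) = x i a" if "i < k" "a < ns i" for i a
    using E_diag[OF that] by (simp add: y_def)
  have y_pos: "y r > 0" if "r < n" for r
    using that unfolding n by (rule offset_cases) (simp add: y x)
  have E_eq: "E = mat_adjoint (mat_adjoint W) * mat_diag n (\<lambda>i. complex_of_real (l i)) * mat_adjoint W"
  proof -
    have "W * (mat_adjoint W * E * W) * mat_adjoint W = (W * mat_adjoint W) * E * (W * mat_adjoint W)"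
      using W aW Ec by (simp add: assoc mult_carrier_mat[of _ n n])
    then show ?thesis unfolding WE W2 using Ec by simp
  qed
  have pos: "1 + t powr - p > 0" for t :: real by (simp add: add_pos_nonneg)
  have "(\<Sum>r<n. ln (1 + y r powr - p)) \<le> (\<Sum>r<n. ln (1 + l r powr - p))"
    using unitary_congruence_trace_convex[OF aW _ convex_ln_one_plus_powr[OF assms(7)], of l]
    unfolding y_def E_eq[symmetric] using W2 l by simp
  then have "ln (\<Prod>r<n. 1 + y r powr - p) \<le> ln (\<Prod>r<n. 1 + l r powr - p)"
    using pos by (simp add: ln_prod less_imp_neq[symmetric])
  then have "(\<Prod>r<n. 1 + y r powr - p) \<le> (\<Prod>r<n. 1 + l r powr - p)"
    using pos by (simp add: prod_pos)
  also have "(\<Prod>r<n. 1 + y r powr - p) = (\<Prod>i<k. \<Prod>a<ns i. 1 + x i a powr - p)"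
    unfolding n prod_over_blocks by (simp add: y)
  finally show ?thesis unfolding Let_def L R by (simp only: Reals_of_real Re_complex_of_real simp_thms)
qed

end
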